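(* Given $w^k=(x^k,y^k)$ and $w^{k+1}=(x^{k+1},y^{k+1})$ in $\mathbb R^n\times\mathbb R^m$, the (first-order) optimality conditions of the two subproblems $$x^{k+1}\in\arg\min_x\Bigl\{L_\sigma(x,y^k)+\tfrac12\|x-x^k\|_P^2\Bigr\},\qquad y^{k+1}\in\arg\max_y\Bigl\{L_\sigma(2x^{k+1}-x^k,y)-\tfrac12\|y-y^k\|_Q^2\Bigr\}$$ are equivalent to the inclusion $$\mathcal Mw^k\in\mathcal Mw^{k+1}+\mathcal T(w^{k+1}).$$ Consequently, whenever the resolvent $(\mathcal M+\mathcal T)^{-1}$ is well defined and single-valued at $\mathcal Mw^k$, the update is exactly $w^{k+1}=(\mathcal M+\mathcal T)^{-1}\mathcal Mw^k$. If, in addition, $\mathcal M\succeq0$, this is a degenerate preconditioned proximal point representation.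
   Context: Setting: $A\in\mathbb R^{m\times n}$, $b\in\mathbb R^m$, $\sigma\ge0$; $f:\mathbb R^n\to\mathbb R$ is convex and continuously differentiable with Lipschitz continuous gradient; $g:\mathbb R^n\to(-\infty,+\infty]$ is proper, closed and convex; $\Phi:=f+g$. $P\in\mathbb R^{n\times n}$ and $Q\in\mathbb R^{m\times m}$ are self-adjoint positive semidefinite, with $\|u\|_P^2=\langle u,Pu\rangle$, and similarly for $Q$. The augmented Lagrangian is $$L_\sigma(x,y)=f(x)+g(x)-\langle y,Ax-b\rangle+\tfrac\sigma2\|Ax-b\|^2 .$$ Define $$\mathcal M=\begin{pmatrix} P & A^\top \\ A & Q \end{pmatrix},\qquad\mathcal T(x,y)=\begin{pmatrix} \partial\Phi(x)-A^\top y+\sigma A^\top(Ax-b) \\ Ax-b \end{pmatrix}.$$ A degenerate preconditioned proximal point iteration is an iteration $w^{k+1}=(\mathcal M+\mathcal T)^{-1}\mathcal Mw^k$ with a bounded self-adjoint positive semidefinite $\mathcal M$. The optimality conditions of the subproblems are $0\in\partial\Phi(x^{k+1})-A^\top y^k+\sigma A^\top(Ax^{k+1}-b)+P(x^{k+1}-x^k)$ and $0=-A(2x^{k+1}-x^k)+b-Q(y^{k+1}-y^k)$. *)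

theory Defs
  imports "HOL-Analysis.Analysis"
begin

definition ereal_epigraph :: "('a \<Rightarrow> ereal) \<Rightarrow> ('a \<times> real) set" where
  "ereal_epigraph h = {(x, r). h x \<le> ereal r}"

definition proper_fun :: "('a \<Rightarrow> ereal) \<Rightarrow> bool" where
  "proper_fun h \<longleftrightarrow> (\<forall>x. h x \<noteq> -\<infinity>) \<and> (\<exists>x. h x \<noteq> \<infinity>)"

definition closed_fun :: "('a::topological_space \<Rightarrow> ereal) \<Rightarrow> bool" where
  "closed_fun h \<longleftrightarrow> closed (ereal_epigraph h)"

definition convex_fun :: "('a::real_vector \<Rightarrow> ereal) \<Rightarrow> bool" where
  "convex_fun h \<longleftrightarrow> convex (ereal_epigraph h)"

text \<open>The convex subdifferential; it is empty at points where \<open>h\<close> is not finite.\<close>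

definition subdifferential :: "('a::real_inner \<Rightarrow> ereal) \<Rightarrow> 'a \<Rightarrow> 'a set" where
  "subdifferential h x =
     {v. \<bar>h x\<bar> \<noteq> \<infinity> \<and> (\<forall>z. h x + ereal (v \<bullet> (z - x)) \<le> h z)}"

definition C1_lipschitz_gradient :: "('a::real_inner \<Rightarrow> real) \<Rightarrow> bool" where
  "C1_lipschitz_gradient f \<longleftrightarrow>
     (\<exists>G L. (\<forall>x. GDERIV f x :> G x) \<and> continuous_on UNIV G \<and> L-lipschitz_on UNIV G)"

definition psd_matrix :: "real^'n^'n \<Rightarrow> bool" where
  "psd_matrix P \<longleftrightarrow> transpose P = P \<and> (\<forall>u. 0 \<le> u \<bullet> (P *v u))"

definition seminorm_sq :: "real^'n^'n \<Rightarrow> real^'n \<Rightarrow> real" where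
  "seminorm_sq P u = u \<bullet> (P *v u)"

definition op_nonneg :: "('a::real_inner \<Rightarrow> 'a) \<Rightarrow> bool" where
  "op_nonneg M \<longleftrightarrow> (\<forall>w. 0 \<le> w \<bullet> M w)"

definition op_sum :: "('a::plus \<Rightarrow> 'a) \<Rightarrow> ('a \<Rightarrow> 'a set) \<Rightarrow> 'a \<Rightarrow> 'a set" where
  "op_sum M T w = {M w + t |t. t \<in> T w}"

text \<open>The set-valued inverse of \<open>M + T\<close>.  It is well defined and single-valued at \<open>z\<close>
  precisely if \<open>resolvent M T z\<close> is a singleton.\<close>

definition resolvent :: "('a::plus \<Rightarrow> 'a) \<Rightarrow> ('a \<Rightarrow> 'a set) \<Rightarrow> 'a \<Rightarrow> 'a set" where
  "resolvent M T z = {w. z \<in> op_sum M T w}"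

definition single_valued_at :: "('a \<Rightarrow> 'a set) \<Rightarrow> 'a \<Rightarrow> bool" where
  "single_valued_at R z \<longleftrightarrow> (\<exists>w. R z = {w})"

definition degenerate_preconditioner :: "('a::real_inner \<Rightarrow> 'a) \<Rightarrow> bool" where
  "degenerate_preconditioner M \<longleftrightarrow> bounded_linear M \<and> adjoint M = M \<and> op_nonneg M"

definition degenerate_ppp_step ::
    "('a::real_inner \<Rightarrow> 'a) \<Rightarrow> ('a \<Rightarrow> 'a set) \<Rightarrow> 'a \<Rightarrow> 'a \<Rightarrow> bool" where
  "degenerate_ppp_step M T w w' \<longleftrightarrow>
     degenerate_preconditioner M \<and> resolvent M T (M w) = {w'}"

definition degenerate_ppp_iteration ::
    "('a::real_inner \<Rightarrow> 'a) \<Rightarrow> ('a \<Rightarrow> 'a set) \<Rightarrow> (nat \<Rightarrow> 'a) \<Rightarrow> bool" where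
  "degenerate_ppp_iteration M T w \<longleftrightarrow> (\<forall>k. degenerate_ppp_step M T (w k) (w (Suc k)))"

definition objective :: "(real^'n \<Rightarrow> real) \<Rightarrow> (real^'n \<Rightarrow> ereal) \<Rightarrow> real^'n \<Rightarrow> ereal" where
  "objective f g x = ereal (f x) + g x"

definition aug_lagrangian ::
    "(real^'n \<Rightarrow> real) \<Rightarrow> (real^'n \<Rightarrow> ereal) \<Rightarrow> real^'n^'m \<Rightarrow> real^'m \<Rightarrow> real
      \<Rightarrow> real^'n \<Rightarrow> real^'m \<Rightarrow> ereal" where
  "aug_lagrangian f g A b \<sigma> x y =
     ereal (f x) + g x - ereal (y \<bullet> (A *v x - b)) + ereal (\<sigma> / 2 * (norm (A *v x - b))\<^sup>2)"

definition solves_x_subproblem ::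
    "(real^'n \<Rightarrow> real) \<Rightarrow> (real^'n \<Rightarrow> ereal) \<Rightarrow> real^'n^'m \<Rightarrow> real^'m \<Rightarrow> real
      \<Rightarrow> real^'n^'n \<Rightarrow> (real^'n) \<times> (real^'m) \<Rightarrow> real^'n \<Rightarrow> bool" where
  "solves_x_subproblem f g A b \<sigma> P = (\<lambda>(x, y) x'.
     is_arg_min (\<lambda>u. aug_lagrangian f g A b \<sigma> u y + ereal (1/2 * seminorm_sq P (u - x)))
       (\<lambda>_. True) x')"

definition solves_y_subproblem ::
    "(real^'n \<Rightarrow> real) \<Rightarrow> (real^'n \<Rightarrow> ereal) \<Rightarrow> real^'n^'m \<Rightarrow> real^'m \<Rightarrow> real
      \<Rightarrow> real^'m^'m \<Rightarrow> (real^'n) \<times> (real^'m) \<Rightarrow> (real^'n) \<times> (real^'m) \<Rightarrow> bool" where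
  "solves_y_subproblem f g A b \<sigma> Q = (\<lambda>(x, y) (x', y').
     is_arg_max (\<lambda>v. aug_lagrangian f g A b \<sigma> (2 *\<^sub>R x' - x) v
                      - ereal (1/2 * seminorm_sq Q (v - y)))
       (\<lambda>_. True) y')"

definition x_optimality ::
    "(real^'n \<Rightarrow> real) \<Rightarrow> (real^'n \<Rightarrow> ereal) \<Rightarrow> real^'n^'m \<Rightarrow> real^'m \<Rightarrow> real
      \<Rightarrow> real^'n^'n \<Rightarrow> (real^'n) \<times> (real^'m) \<Rightarrow> real^'n \<Rightarrow> bool" where
  "x_optimality f g A b \<sigma> P = (\<lambda>(x, y) x'.
     0 \<in> {u - transpose A *v y + \<sigma> *\<^sub>R (transpose A *v (A *v x' - b)) + P *v (x' - x) |u.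
           u \<in> subdifferential (objective f g) x'})"

text \<open>Stationarity in \<open>y\<close> of \<open>L\<^sub>\<sigma>(2x' - x, y) - 1/2 \<parallel>y - y\<^sub>k\<parallel>\<^sub>Q\<^sup>2\<close>; the \<open>y\<close>-independent
  and possibly infinite term \<open>g (2x' - x)\<close> does not enter.\<close>

definition y_optimality ::
    "real^'n^'m \<Rightarrow> real^'m \<Rightarrow> real^'m^'m \<Rightarrow> (real^'n) \<times> (real^'m) \<Rightarrow> (real^'n) \<times> (real^'m) \<Rightarrow> bool" where
  "y_optimality A b Q = (\<lambda>(x, y) (x', y').
     0 = - (A *v (2 *\<^sub>R x' - x)) + b - Q *v (y' - y))"

definition optimality_conditions ::
    "(real^'n \<Rightarrow> real) \<Rightarrow> (real^'n \<Rightarrow> ereal) \<Rightarrow> real^'n^'m \<Rightarrow> real^'m \<Rightarrow> real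
      \<Rightarrow> real^'n^'n \<Rightarrow> real^'m^'m \<Rightarrow> (real^'n) \<times> (real^'m) \<Rightarrow> (real^'n) \<times> (real^'m) \<Rightarrow> bool" where
  "optimality_conditions f g A b \<sigma> P Q w w' \<longleftrightarrow>
     x_optimality f g A b \<sigma> P w (fst w') \<and> y_optimality A b Q w w'"

definition block_M ::
    "real^'n^'m \<Rightarrow> real^'n^'n \<Rightarrow> real^'m^'m \<Rightarrow> (real^'n) \<times> (real^'m) \<Rightarrow> (real^'n) \<times> (real^'m)" where
  "block_M A P Q = (\<lambda>(x, y). (P *v x + transpose A *v y, A *v x + Q *v y))"

definition block_T ::
    "(real^'n \<Rightarrow> real) \<Rightarrow> (real^'n \<Rightarrow> ereal) \<Rightarrow> real^'n^'m \<Rightarrow> real^'m \<Rightarrow> real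
      \<Rightarrow> (real^'n) \<times> (real^'m) \<Rightarrow> ((real^'n) \<times> (real^'m)) set" where
  "block_T f g A b \<sigma> = (\<lambda>(x, y).
     {(u - transpose A *v y + \<sigma> *\<^sub>R (transpose A *v (A *v x - b)), A *v x - b) |u.
        u \<in> subdifferential (objective f g) x})"

end

theory Submission
  imports Defs
begin

text \<open>
  The inclusion in \<open>M + T\<close> is a componentwise rearrangement of the two optimality conditions: the
  off-diagonal blocks of \<open>M\<close> turn \<open>A\<^sup>T y\<^sub>k\<^sub>+\<^sub>1\<close> into \<open>A\<^sup>T y\<^sub>k\<close> and \<open>A x\<^sub>k\<^sub>+\<^sub>1\<close> into \<open>A (2 x\<^sub>k\<^sub>+\<^sub>1 - x\<^sub>k)\<close>.
  Each subproblem minimizes the sum of a convex function \<open>h\<close> and a convex quadratic \<open>q\<close> (with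
  \<open>h = 0\<close> in the second one). As \<open>q\<close> equals its second-order expansion, which has a nonnegative
  remainder of order \<open>t\<^sup>2\<close> along segments, minimality at \<open>x\<close> means exactly
  \<open>- grad q x \<in> subdifferential h x\<close>.
\<close>

section \<open>Convex extended-real functions and minimality of a convex function plus a
  quadratic\<close>

lemma convex_fun_segment:
  fixes h :: "'a::real_vector \<Rightarrow> ereal"
  assumes "convex_fun h" "h x = ereal a" "h z = ereal b" "0 \<le> t" "t \<le> 1"
  shows "h (x + t *\<^sub>R (z - x)) \<le> ereal (a + t * (b - a))"
proof -
  have "(1 - t) *\<^sub>R (x, a) + t *\<^sub>R (z, b) \<in> ereal_epigraph h"
    using assms by (intro convexD) (auto simp: convex_fun_def ereal_epigraph_def)
  moreover have "(1 - t) *\<^sub>R (x, a) + t *\<^sub>R (z, b) = (x + t *\<^sub>R (z - x), a + t * (b - a))"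
    by (simp add: algebra_simps)
  ultimately show ?thesis
    by (simp add: ereal_epigraph_def)
qed

text \<open>The shear \<open>(x, r)\<close> to \<open>(x, r - f x)\<close> maps the epigraph of
  \<open>objective f g\<close> onto that of \<open>g\<close>. Convexity of the latter, combined with
  the convexity inequality for \<open>f\<close>, gives the claim.\<close>

lemma convex_fun_objective:
  assumes "convex_on UNIV f" "convex_fun g"
  shows "convex_fun (objective f g)"
  unfolding convex_fun_def
proof (rule convexI)
  have epi: "(x, r) \<in> ereal_epigraph (objective f g) \<longleftrightarrow> (x, r - f x) \<in> ereal_epigraph g" for x r
    by (cases "g x") (auto simp: ereal_epigraph_def objective_def)
  fix p p' :: "(real^'a) \<times> real" and u v :: real
  assume p: "p \<in> ereal_epigraph (objective f g)" "p' \<in> ereal_epigraph (objective f g)"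
    and uv: "0 \<le> u" "0 \<le> v" "u + v = 1"
  obtain x r x' r' where [simp]: "p = (x, r)" "p' = (x', r')"
    by (metis surj_pair)
  have "u *\<^sub>R (x, r - f x) + v *\<^sub>R (x', r' - f x') \<in> ereal_epigraph g"
    using p uv assms(2) by (intro convexD) (auto simp: convex_fun_def epi)
  then have "g (u *\<^sub>R x + v *\<^sub>R x') \<le> ereal (u * (r - f x) + v * (r' - f x'))"
    by (simp add: ereal_epigraph_def)
  also have "f (u *\<^sub>R x + v *\<^sub>R x') \<le> u * f x + v * f x'"
    using assms(1) uv by (simp add: convex_on_def)
  then have "ereal (u * (r - f x) + v * (r' - f x'))
      \<le> ereal (u * r + v * r' - f (u *\<^sub>R x + v *\<^sub>R x'))"
    by (simp add: algebra_simps)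
  finally show "u *\<^sub>R p + v *\<^sub>R p' \<in> ereal_epigraph (objective f g)"
    by (simp add: epi) (simp add: ereal_epigraph_def)
qed

lemma proper_fun_objective:
  assumes "proper_fun g"
  shows "proper_fun (objective f g)"
  using assms by (auto simp: proper_fun_def objective_def)

text \<open>Here \<open>c\<close> is the gradient of \<open>q\<close> at \<open>x\<close> and
  \<open>N\<close> the second-order remainder. Comparing \<open>x\<close> with
  \<open>x + t *\<^sub>R d\<close>, dividing by \<open>t\<close> and letting \<open>t\<close> tend
  to 0 gives the subgradient inequality. Conversely, that inequality added to the expansion of
  \<open>q\<close> gives minimality because \<open>N\<close> is nonnegative.\<close>

lemma is_arg_min_add_quadratic_iff:
  fixes h :: "'a::real_inner \<Rightarrow> ereal"
  assumes h: "convex_fun h" "proper_fun h"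
    and q: "\<And>d. q (x + d) = q x + c \<bullet> d + N d"
    and N: "\<And>d. N d \<ge> 0" "\<And>t d. N (t *\<^sub>R d) = t\<^sup>2 * N d"
  shows "is_arg_min (\<lambda>u. h u + ereal (q u)) (\<lambda>_. True) x \<longleftrightarrow> - c \<in> subdifferential h x"
proof
  assume "is_arg_min (\<lambda>u. h u + ereal (q u)) (\<lambda>_. True) x"
  then have min: "h x + ereal (q x) \<le> h u + ereal (q u)" for u
    by (simp add: is_arg_min_def not_less)
  obtain u where u: "h u \<noteq> \<infinity>" and ninf: "\<And>z. h z \<noteq> - \<infinity>"
    using h(2) by (auto simp: proper_fun_def)
  \<comment> \<open>Minimality against a point where \<open>h\<close> is not \<infinity> bounds
    \<open>h x\<close> above, and properness excludes -\<infinity>.\<close>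
  then obtain a where a: "h x = ereal a"
    using min[of u] by (cases "h u"; cases "h x") auto
  have "h x + ereal (- c \<bullet> (z - x)) \<le> h z" for z
  proof (cases "h z")
    case (real b)
    define d where "d = z - x"
    have *: "0 \<le> b - a + c \<bullet> d + t * N d" if t: "0 < t" "t \<le> 1" for t
    proof -
      have "ereal (a + q x) \<le> h (x + t *\<^sub>R d) + ereal (q (x + t *\<^sub>R d))"
        using min[of "x + t *\<^sub>R d"] by (simp add: a)
      also have "\<dots> \<le> ereal (a + t * (b - a)) + ereal (q (x + t *\<^sub>R d))"
        using convex_fun_segment[OF h(1) a real, of t] t unfolding d_def
        by (intro add_right_mono) auto
      \<comment> \<open>The terms \<open>a + q x\<close> cancel, and
        \<open>N (t *\<^sub>R d)\<close> contributes a factor \<open>t\<^sup>2\<close>, so one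
        factor \<open>t > 0\<close> can be divided out.\<close>
      finally have "0 \<le> t * (b - a + c \<bullet> d + t * N d)"
        by (simp add: q N algebra_simps power2_eq_square)
      then show ?thesis
        using t by (simp add: zero_le_mult_iff)
    qed
    have "((\<lambda>t. b - a + c \<bullet> d + t * N d) \<longlongrightarrow> b - a + c \<bullet> d + 0 * N d) (at_right 0)"
      by (intro tendsto_intros)
    moreover have "\<forall>\<^sub>F t in at_right 0. 0 \<le> b - a + c \<bullet> d + t * N d"
      using * by (auto simp: eventually_at_right_field intro!: exI[of _ 1])
    ultimately have "0 \<le> b - a + c \<bullet> d + 0 * N d"
      by (intro tendsto_lowerbound[of _ _ "at_right 0"]) auto
    then show ?thesis
      by (simp add: a real d_def)
  qed (use ninf in auto)
  then show "- c \<in> subdifferential h x"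
    by (simp add: subdifferential_def a)
next
  assume "- c \<in> subdifferential h x"
  then obtain a where a: "h x = ereal a" and sub: "\<And>z. h x + ereal (- c \<bullet> (z - x)) \<le> h z"
    by (auto simp: subdifferential_def)
  have "h x + ereal (q x) \<le> h z + ereal (q z)" for z
  proof -
    have "q z = q x + c \<bullet> (z - x) + N (z - x)"
      using q[of "z - x"] by simp
    then show ?thesis
      using sub[of z] N(1)[of "z - x"] by (cases "h z") (auto simp: a)
  qed
  then show "is_arg_min (\<lambda>u. h u + ereal (q u)) (\<lambda>_. True) x"
    by (simp add: is_arg_min_def not_less)
qed

lemma subdifferential_zero: "subdifferential (\<lambda>_. 0) x = {0}"
proof -
  \<comment> \<open>Testing at \<open>z = x + v\<close> gives
    \<open>v \<bullet> v \<le> 0\<close>.\<close>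
  have "v = 0" if "\<forall>z. v \<bullet> (z - x) \<le> 0" for v
    using that[rule_format, of "x + v"] inner_gt_zero_iff[of v] by (simp add: not_less[symmetric])
  then show ?thesis
    by (auto simp: subdifferential_def zero_ereal_def)
qed

section \<open>Quadratic forms and the two subproblems\<close>

lemma psd_matrix_inner_swap:
  assumes "psd_matrix P"
  shows "u \<bullet> (P *v v) = (P *v u) \<bullet> v"
  using assms dot_lmul_matrix[of u P v]
  by (metis psd_matrix_def vector_transpose_matrix)

lemma seminorm_sq_add:
  assumes "psd_matrix P"
  shows "seminorm_sq P (u + d) = seminorm_sq P u + 2 * ((P *v u) \<bullet> d) + seminorm_sq P d"
  using psd_matrix_inner_swap[OF assms, of u d]
  by (simp add: seminorm_sq_def matrix_vector_right_distrib inner_add_left inner_add_right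
      inner_commute)

lemma seminorm_sq_scaleR: "seminorm_sq P (t *\<^sub>R d) = t\<^sup>2 * seminorm_sq P d"
  by (simp add: seminorm_sq_def matrix_vector_mult_scaleR power2_eq_square)

lemma seminorm_sq_nonneg: "psd_matrix P \<Longrightarrow> 0 \<le> seminorm_sq P d"
  by (simp add: seminorm_sq_def psd_matrix_def)

lemma inner_transpose_mult: "(transpose A *v v) \<bullet> u = v \<bullet> (A *v u)"
  for A :: "real^'n^'m"
  by (simp add: dot_lmul_matrix)

text \<open>Apart from \<open>f + g\<close>, every term of the subproblem is quadratic in the
  variable. Keeping \<open>f\<close> together with \<open>g\<close> in the convex part yields the
  subdifferential of the whole objective, as it occurs in \<open>block_T\<close>.\<close>

lemma solves_x_subproblem_iff:
  assumes "\<sigma> \<ge> 0" "convex_on UNIV f" "proper_fun g" "convex_fun g" "psd_matrix P"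
  shows "solves_x_subproblem f g A b \<sigma> P (x, y) x' \<longleftrightarrow> x_optimality f g A b \<sigma> P (x, y) x'"
proof -
  define q where "q u = - (y \<bullet> (A *v u - b)) + \<sigma> / 2 * (norm (A *v u - b))\<^sup>2
    + 1/2 * seminorm_sq P (u - x)" for u
  \<comment> \<open>\<open>N\<close> is half the quadratic form of \<sigma> A^T A + P, the Hessian
    of \<open>q\<close>, and \<open>c\<close> is the gradient of \<open>q\<close> at
    \<open>x'\<close>.\<close>
  define N where "N d = \<sigma> / 2 * (norm (A *v d))\<^sup>2 + 1/2 * seminorm_sq P d" for d
  define c where "c = - (transpose A *v y) + \<sigma> *\<^sub>R (transpose A *v (A *v x' - b)) + P *v (x' - x)"
  have "aug_lagrangian f g A b \<sigma> u y + ereal (1/2 * seminorm_sq P (u - x))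
      = objective f g u + ereal (q u)" for u
    by (cases "g u") (auto simp: aug_lagrangian_def objective_def q_def)
  moreover have "q (x' + d) = q x' + c \<bullet> d + N d" for d
  proof -
    have A: "A *v (x' + d) - b = (A *v x' - b) + A *v d"
      by (simp add: matrix_vector_right_distrib)
    have P: "x' + d - x = (x' - x) + d"
      by simp
    show ?thesis
      unfolding q_def A P N_def c_def seminorm_sq_add[OF assms(5)] power2_norm_eq_inner
      by (simp only: inner_add_left inner_add_right inner_minus_left inner_scaleR_left
            inner_transpose_mult inner_commute[of "A *v d" "A *v x' - b"])
        (simp add: field_simps)
  qed
  moreover have "N d \<ge> 0" for d
    using assms(1) seminorm_sq_nonneg[OF assms(5)] by (simp add: N_def)
  moreover have "N (t *\<^sub>R d) = t\<^sup>2 * N d" for t d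
    by (simp add: N_def matrix_vector_mult_scaleR seminorm_sq_scaleR power_mult_distrib algebra_simps)
  ultimately have "solves_x_subproblem f g A b \<sigma> P (x, y) x'
      \<longleftrightarrow> - c \<in> subdifferential (objective f g) x'"
    unfolding solves_x_subproblem_def
    using is_arg_min_add_quadratic_iff[of "objective f g" q x' c N]
      convex_fun_objective[OF assms(2,4)] proper_fun_objective[OF assms(3)]
    by simp
  also have "\<dots> \<longleftrightarrow> x_optimality f g A b \<sigma> P (x, y) x'"
  proof -
    have "0 = u - transpose A *v y + \<sigma> *\<^sub>R (transpose A *v (A *v x' - b)) + P *v (x' - x)
        \<longleftrightarrow> u = - c" for u
      unfolding c_def by (auto simp: algebra_simps eq_neg_iff_add_eq_0)
    then show ?thesis
      by (auto simp: x_optimality_def)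
  qed
  finally show ?thesis .
qed

text \<open>With \<open>g\<close> finite at the extrapolated point, the function to maximize is a
  real constant minus a convex quadratic. If \<open>g\<close> were \<infinity> there, that function
  would be \<infinity> everywhere and every \<open>y'\<close> a maximizer, whatever the stationarity
  equation says.\<close>

lemma solves_y_subproblem_iff:
  fixes A :: "real^'n^'m"
  assumes "psd_matrix Q" "\<bar>g (2 *\<^sub>R x' - x)\<bar> \<noteq> \<infinity>"
  shows "solves_y_subproblem f g A b \<sigma> Q (x, y) (x', y') \<longleftrightarrow> y_optimality A b Q (x, y) (x', y')"
proof -
  define r where "r = A *v (2 *\<^sub>R x' - x) - b"
  define q where "q v = v \<bullet> r + 1/2 * seminorm_sq Q (v - y)" for v
  define c where "c = r + Q *v (y' - y)"
  obtain \<gamma> where \<gamma>: "g (2 *\<^sub>R x' - x) = ereal \<gamma>"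
    using assms(2) by auto
  have "aug_lagrangian f g A b \<sigma> (2 *\<^sub>R x' - x) v - ereal (1/2 * seminorm_sq Q (v - y))
      = ereal (f (2 *\<^sub>R x' - x) + \<gamma> + \<sigma> / 2 * (norm r)\<^sup>2 - q v)" for v
    by (simp add: aug_lagrangian_def \<gamma> q_def r_def)
  \<comment> \<open>Dropping the constant and changing the sign turns the maximization into a
    minimization; the summand \<open>0\<close> is the convex part.\<close>
  then have "solves_y_subproblem f g A b \<sigma> Q (x, y) (x', y')
      \<longleftrightarrow> is_arg_min (\<lambda>v. 0 + ereal (q v)) (\<lambda>_. True) y'"
    by (simp add: solves_y_subproblem_def is_arg_max_def is_arg_min_def)
  also have "\<dots> \<longleftrightarrow> - c \<in> subdifferential (\<lambda>_. 0) y'"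
  proof (rule is_arg_min_add_quadratic_iff)
    have "ereal_epigraph (\<lambda>_::real^'m. 0) = UNIV \<times> {0..}"
      by (auto simp: ereal_epigraph_def)
    then show "convex_fun (\<lambda>_::real^'m. 0)"
      by (simp add: convex_fun_def convex_Times)
    show "proper_fun (\<lambda>_::real^'m. 0)"
      by (simp add: proper_fun_def)
    show "q (y' + d) = q y' + c \<bullet> d + 1/2 * seminorm_sq Q d" for d
    proof -
      have "y' + d - y = (y' - y) + d"
        by simp
      then show ?thesis
        unfolding q_def c_def
        by (simp only: seminorm_sq_add[OF assms(1)] inner_add_left inner_commute[of r])
          (simp add: field_simps)
    qed
  qed (auto simp: seminorm_sq_nonneg[OF assms(1)] seminorm_sq_scaleR)
  \<comment> \<open>The only subgradient of the zero function is 0, so the condition reads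
    \<open>c = 0\<close>, which is the stationarity equation up to sign.\<close>
  also have "\<dots> \<longleftrightarrow> y_optimality A b Q (x, y) (x', y')"
    by (auto simp: subdifferential_zero y_optimality_def c_def r_def algebra_simps)
  finally show ?thesis .
qed

section \<open>The block inclusion and the preconditioner\<close>

lemma mem_op_sum_iff: "z \<in> op_sum M T w \<longleftrightarrow> z - M w \<in> T w"
  for z :: "'a::ab_group_add"
  by (auto simp: op_sum_def intro!: exI[of _ "z - M w"])

lemma optimality_conditions_iff:
  "optimality_conditions f g A b \<sigma> P Q w w'
    \<longleftrightarrow> w' \<in> resolvent (block_M A P Q) (block_T f g A b \<sigma>) (block_M A P Q w)"
proof -
  obtain x y x' y' where [simp]: "w = (x, y)" "w' = (x', y')"
    by (metis surj_pair)
  \<comment> \<open>\<open>s\<close> stands for the penalty term, which is carried along unchanged;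
    the terms in \<open>transpose A *v y'\<close> from \<open>block_M\<close> and
    \<open>block_T\<close> cancel.\<close>
  have x_eq: "0 = u - transpose A *v y + s + P *v (x' - x)
      \<longleftrightarrow> P *v x + transpose A *v y - (P *v x' + transpose A *v y') = u - transpose A *v y' + s"
    for u s
    by (auto simp: matrix_vector_mult_diff_distrib algebra_simps)
  \<comment> \<open>One copy of \<open>A *v x'\<close> comes from \<open>block_M\<close>, the other
    from \<open>block_T\<close>.\<close>
  have "A *v (2 *\<^sub>R x' - x) = A *v x' + A *v x' - A *v x"
    by (simp only: scaleR_2 matrix_vector_mult_diff_distrib matrix_vector_right_distrib)
  then have y_eq: "0 = - (A *v (2 *\<^sub>R x' - x)) + b - Q *v (y' - y)
      \<longleftrightarrow> A *v x + Q *v y - (A *v x' + Q *v y') = A *v x' - b"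
    by (auto simp: matrix_vector_mult_diff_distrib algebra_simps)
  show ?thesis
    by (simp only: \<open>w = (x, y)\<close> \<open>w' = (x', y')\<close> optimality_conditions_def x_optimality_def
        y_optimality_def resolvent_def mem_op_sum_iff block_M_def block_T_def mem_Collect_eq
        prod.case fst_conv diff_Pair prod.inject x_eq y_eq) (auto simp only:)
qed

text \<open>Self-adjointness holds because the diagonal blocks are symmetric and the off-diagonal
  blocks are transposes of each other; boundedness is automatic in finite dimension. Nonnegativity
  has to be assumed: it does not follow from that of \<open>P\<close> and \<open>Q\<close>, as
  \<open>P = 0\<close>, \<open>Q = 0\<close> with nonzero \<open>A\<close> shows.\<close>

lemma degenerate_preconditioner_block_M:
  assumes "psd_matrix P" "psd_matrix Q" "op_nonneg (block_M A P Q)"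
  shows "degenerate_preconditioner (block_M A P Q)"
proof -
  have "linear (block_M A P Q)"
    by (rule linearI)
      (auto simp: block_M_def matrix_vector_right_distrib matrix_vector_mult_scaleR algebra_simps
        simp del: transpose_matrix_vector)
  moreover have "adjoint (block_M A P Q) = block_M A P Q"
  proof (rule adjoint_unique, intro allI)
    fix w w' :: "(real^'a) \<times> (real^'b)"
    obtain x y x' y' where [simp]: "w = (x, y)" "w' = (x', y')"
      by (metis surj_pair)
    show "block_M A P Q w \<bullet> w' = w \<bullet> block_M A P Q w'"
      using inner_transpose_mult[of A y x'] inner_transpose_mult[of A y' x]
        psd_matrix_inner_swap[OF assms(1), of x x'] psd_matrix_inner_swap[OF assms(2), of y y']
      by (simp add: block_M_def inner_add_left inner_add_right inner_commute
          del: transpose_matrix_vector)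
  qed
  ultimately show ?thesis
    using assms(3) by (simp add: degenerate_preconditioner_def linear_conv_bounded_linear)
qed

theorem proposition1:
  fixes A :: "real^'n^'m" and b :: "real^'m" and \<sigma> :: real
    and f :: "real^'n \<Rightarrow> real" and g :: "real^'n \<Rightarrow> ereal"
    and P :: "real^'n^'n" and Q :: "real^'m^'m"
    and x0 x1 :: "real^'n" and y0 y1 :: "real^'m"
  assumes "\<sigma> \<ge> 0"
    and "convex_on UNIV f" and "C1_lipschitz_gradient f"
    and "proper_fun g" and "closed_fun g" and "convex_fun g"
    and "psd_matrix P" and "psd_matrix Q"
  shows
    "(solves_x_subproblem f g A b \<sigma> P (x0, y0) x1 \<longleftrightarrow> x_optimality f g A b \<sigma> P (x0, y0) x1) \<and>
     (g (2 *\<^sub>R x1 - x0) \<noteq> \<infinity> \<longrightarrow>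
        (solves_y_subproblem f g A b \<sigma> Q (x0, y0) (x1, y1) \<longleftrightarrow>
         y_optimality A b Q (x0, y0) (x1, y1))) \<and>
     (optimality_conditions f g A b \<sigma> P Q (x0, y0) (x1, y1) \<longleftrightarrow>
        block_M A P Q (x0, y0) \<in> op_sum (block_M A P Q) (block_T f g A b \<sigma>) (x1, y1)) \<and>
     (single_valued_at (resolvent (block_M A P Q) (block_T f g A b \<sigma>)) (block_M A P Q (x0, y0)) \<longrightarrow>
        (optimality_conditions f g A b \<sigma> P Q (x0, y0) (x1, y1) \<longleftrightarrow>
         resolvent (block_M A P Q) (block_T f g A b \<sigma>) (block_M A P Q (x0, y0)) = {(x1, y1)})) \<and>
     (op_nonneg (block_M A P Q) \<longrightarrow>
        (single_valued_at (resolvent (block_M A P Q) (block_T f g A b \<sigma>)) (block_M A P Q (x0, y0)) \<longrightarrow>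
           (optimality_conditions f g A b \<sigma> P Q (x0, y0) (x1, y1) \<longleftrightarrow>
            degenerate_ppp_step (block_M A P Q) (block_T f g A b \<sigma>) (x0, y0) (x1, y1))) \<and>
        (\<forall>w. (\<forall>k. single_valued_at (resolvent (block_M A P Q) (block_T f g A b \<sigma>))
                     (block_M A P Q (w k))) \<longrightarrow>
           ((\<forall>k. optimality_conditions f g A b \<sigma> P Q (w k) (w (Suc k))) \<longleftrightarrow>
            degenerate_ppp_iteration (block_M A P Q) (block_T f g A b \<sigma>) w)))"
proof -
  let ?M = "block_M A P Q" and ?T = "block_T f g A b \<sigma>"
  \<comment> \<open>For a singleton resolvent, containing \<open>w'\<close> and being equal to
    \<open>{w'}\<close> coincide. The pair \<open>w\<close>, \<open>w'\<close> is arbitrary so that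
    the claim also applies along a whole sequence.\<close>
  have step: "optimality_conditions f g A b \<sigma> P Q w w' \<longleftrightarrow> resolvent ?M ?T (?M w) = {w'}"
    if "single_valued_at (resolvent ?M ?T) (?M w)" for w w'
    using that by (auto simp: single_valued_at_def optimality_conditions_iff)
  have inclusion: "optimality_conditions f g A b \<sigma> P Q (x0, y0) (x1, y1)
      \<longleftrightarrow> ?M (x0, y0) \<in> op_sum ?M ?T (x1, y1)"
    by (simp add: optimality_conditions_iff resolvent_def)
  have y_step: "solves_y_subproblem f g A b \<sigma> Q (x0, y0) (x1, y1)
      \<longleftrightarrow> y_optimality A b Q (x0, y0) (x1, y1)" if "g (2 *\<^sub>R x1 - x0) \<noteq> \<infinity>"
  proof (rule solves_y_subproblem_iff[OF assms(8)])
    \<comment> \<open>Properness rules out the value -\<infinity>.\<close>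
    show "\<bar>g (2 *\<^sub>R x1 - x0)\<bar> \<noteq> \<infinity>"
      using assms(4) that by (cases "g (2 *\<^sub>R x1 - x0)") (auto simp: proper_fun_def)
  qed
  have ppp_step: "optimality_conditions f g A b \<sigma> P Q w w' \<longleftrightarrow> degenerate_ppp_step ?M ?T w w'"
    if "op_nonneg ?M" "single_valued_at (resolvent ?M ?T) (?M w)" for w w'
    using step[OF that(2)] degenerate_preconditioner_block_M[OF assms(7,8) that(1)]
    unfolding degenerate_ppp_step_def by blast
  have iteration: "(\<forall>k. optimality_conditions f g A b \<sigma> P Q (w k) (w (Suc k)))
      \<longleftrightarrow> degenerate_ppp_iteration ?M ?T w"
    if "op_nonneg ?M" "\<forall>k. single_valued_at (resolvent ?M ?T) (?M (w k))" for w
    unfolding degenerate_ppp_iteration_def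
    using ppp_step[OF that(1) that(2)[rule_format]] by blast
  show ?thesis
    by (intro conjI impI allI solves_x_subproblem_iff[OF assms(1,2,4,6,7)] y_step inclusion step
        ppp_step iteration) blast+
qed

end
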